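(* The property SWMd does not imply the property SWD: there exist a sequence $(\Omega_N)_N$ of finite sets with $\#\Omega_N=N$ and a distance function $d$ on $\mathbf{\Omega}=\bigcup_N\Omega_N$ such that $(\mathbf{\Omega},d)$ is an SWMd but not an SWD.
   Context: For $N\ge 2$ put $d_N=\max\{d(A,B): A,B\in\Omega_N\}$ (the diameter of $\Omega_N$) and $Md_N=$ the median of the multiset $\{\{d(A,B): A,B\in\Omega_N, A\ne B\}\}$. $(\mathbf{\Omega},d)$ is called an SWD (small world based on the diameter) if there is a finite constant $C\ge 0$ with $\lim_{N\to\infty} \frac{d_N}{\ln N}=C$; it is called an SWMd (small world based on the median distance) if there is a finite $C\ge 0$ with $\lim_{N\to\infty}\frac{Md_N}{\ln N}=C$. A distance function is a metric in the usual sense. *)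

theory Defs
  imports "HOL-Analysis.Abstract_Metric_Spaces" "HOL-Library.Multiset"
begin

definition diam_at :: "('a \<Rightarrow> 'a \<Rightarrow> real) \<Rightarrow> 'a set \<Rightarrow> real" where
  "diam_at d S = Max {d A B | A B. A \<in> S \<and> B \<in> S}"

(* For even size this is the mean of the two middle entries of the sorted list; for odd size
   both indices denote the single middle entry. Only meaningful for nonempty M. *)
definition median :: "real multiset \<Rightarrow> real" where
  "median M = (let xs = sorted_list_of_multiset M; n = size M
     in (xs ! ((n - 1) div 2) + xs ! (n div 2)) / 2)"

(* Taken over ordered pairs; as d is symmetric every value is merely doubled with respect to
   unordered pairs, which leaves the median unchanged. *)
definition dist_mset :: "('a \<Rightarrow> 'a \<Rightarrow> real) \<Rightarrow> 'a set \<Rightarrow> real multiset" where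
  "dist_mset d S = image_mset (\<lambda>(A, B). d A B) (mset_set {(A, B). A \<in> S \<and> B \<in> S \<and> A \<noteq> B})"

definition median_dist :: "('a \<Rightarrow> 'a \<Rightarrow> real) \<Rightarrow> 'a set \<Rightarrow> real" where
  "median_dist d S = median (dist_mset d S)"

definition SWD :: "(nat \<Rightarrow> 'a set) \<Rightarrow> ('a \<Rightarrow> 'a \<Rightarrow> real) \<Rightarrow> bool" where
  "SWD \<Omega> d \<longleftrightarrow> (\<exists>C\<ge>0. (\<lambda>N. diam_at d (\<Omega> N) / ln (real N)) \<longlonglongrightarrow> C)"

definition SWMd :: "(nat \<Rightarrow> 'a set) \<Rightarrow> ('a \<Rightarrow> 'a \<Rightarrow> real) \<Rightarrow> bool" where
  "SWMd \<Omega> d \<longleftrightarrow> (\<exists>C\<ge>0. (\<lambda>N. median_dist d (\<Omega> N) / ln (real N)) \<longlonglongrightarrow> C)"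

end

(*
  Take d(A,B) = w(A) + w(B) for distinct A, B, where w is a positive weight; this is a metric.
  Let Omega_N consist of N - 1 points of weight 1/2 and a single point of weight at least N. For large N
  more than half of the pairs avoid that point, so the median distance is 1, while the diameter
  exceeds N.
*)
theory Submission imports Defs "HOL-Real_Asymp.Real_Asymp" begin

text \<open>In a sorted list the copies of \<open>x\<close> are contiguous. If a middle entry
  differed from \<open>x\<close>, all copies would lie strictly on one side of it, which leaves room
  for at most half of the entries.\<close>

lemma median_eq_majority:
  assumes "size M < 2 * count M x"
  shows "median M = x"
proof -
  define xs where "xs = sorted_list_of_multiset M"
  have sorted: "sorted xs" and len: "length xs = size M"
    by (simp_all add: xs_def flip: size_mset)
  have "count M x = count (mset xs) x"
    by (simp add: xs_def)
  also have "\<dots> = card {j. j < length xs \<and> xs ! j = x}"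
    by (simp add: count_mset count_list_eq_length_filter length_filter_conv_card eq_commute)
  finally have count: "count M x = card {j. j < length xs \<and> xs ! j = x}" .
  \<comment> \<open>The range contains exactly the one or two indices that \<open>median\<close>
    averages, so even and odd sizes are handled together.\<close>
  have middle: "xs ! i = x" if "(size M - 1) div 2 \<le> i" "i \<le> size M div 2" for i
  proof (rule ccontr)
    assume "xs ! i \<noteq> x"
    have "size M > 0"
      using assms count_le_size[of M x] by linarith
    then have i: "i < length xs"
      using that by (simp add: len)
    consider "xs ! i < x" | "x < xs ! i"
      using \<open>xs ! i \<noteq> x\<close> by linarith
    then show False
    proof cases
      case 1
      have "{j. j < length xs \<and> xs ! j = x} \<subseteq> {i<..<length xs}"
        using 1 i sorted_nth_mono[OF sorted] by (force simp: not_le[symmetric])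
      from card_mono[OF _ this] have "count M x \<le> size M - Suc i"
        by (simp add: count len)
      with assms that show False by linarith
    next
      case 2
      have "{j. j < length xs \<and> xs ! j = x} \<subseteq> {..<i}"
        using 2 i sorted_nth_mono[OF sorted] by (force simp: not_le[symmetric])
      from card_mono[OF _ this] have "count M x \<le> i"
        by (simp add: count)
      with assms that show False by linarith
    qed
  qed
  have "(size M - 1) div 2 \<le> size M div 2"
    by (intro div_le_mono) simp
  then show ?thesis
    unfolding median_def Let_def xs_def[symmetric] by (simp add: middle)
qed

lemma off_diagonal:
  assumes "finite S"
  shows finite_off_diagonal: "finite {(A, B). A \<in> S \<and> B \<in> S \<and> A \<noteq> B}"
    and card_off_diagonal: "card {(A, B). A \<in> S \<and> B \<in> S \<and> A \<noteq> B} = card S * (card S - 1)"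
proof -
  have eq: "{(A, B). A \<in> S \<and> B \<in> S \<and> A \<noteq> B} = Sigma S (\<lambda>A. S - {A})"
    by auto
  show "finite {(A, B). A \<in> S \<and> B \<in> S \<and> A \<noteq> B}"
    unfolding eq using assms by auto
  show "card {(A, B). A \<in> S \<and> B \<in> S \<and> A \<noteq> B} = card S * (card S - 1)"
    unfolding eq using assms by simp
qed

lemma count_dist_mset_ge:
  assumes "finite S" "E \<subseteq> S"
    and const: "\<And>A B. A \<in> E \<Longrightarrow> B \<in> E \<Longrightarrow> A \<noteq> B \<Longrightarrow> d A B = x"
  shows "card E * (card E - 1) \<le> count (dist_mset d S) x"
proof -
  let ?P = "{(A, B). A \<in> S \<and> B \<in> S \<and> A \<noteq> B}"
  have fin: "finite ?P"
    using assms finite_off_diagonal by blast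
  have "card E * (card E - 1) = card {(A, B). A \<in> E \<and> B \<in> E \<and> A \<noteq> B}"
    using card_off_diagonal[OF finite_subset[OF assms(2,1)]] by (rule sym)
  also have "\<dots> \<le> card ((\<lambda>(A, B). d A B) -` {x} \<inter> ?P)"
    using assms fin by (intro card_mono) auto
  also have "\<dots> = count (dist_mset d S) x"
    unfolding dist_mset_def using fin by (simp add: count_image_mset)
  finally show ?thesis .
qed

text \<open>With n = \<open>card S\<close>, at least (n - 1)(n - 2) of the n(n - 1) ordered pairs
  lie inside \<open>E\<close>. They form a strict majority exactly when n < 2(n - 2), that is n
  \<ge> 5.\<close>

lemma median_dist_eq:
  assumes "finite S" "card S \<ge> 5" "E \<subseteq> S" "card S \<le> Suc (card E)"
    and "\<And>A B. A \<in> E \<Longrightarrow> B \<in> E \<Longrightarrow> A \<noteq> B \<Longrightarrow> d A B = x"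
  shows "median_dist d S = x"
proof -
  \<comment> \<open>This substitution removes truncated subtraction, so that the majority inequality
    is one between polynomials in \<open>m\<close>.\<close>
  obtain m where m: "card S = m + 5"
    using assms(2) by (metis add.commute le_Suc_ex)
  have "size (dist_mset d S) = card S * (card S - 1)"
    using assms(1) by (simp add: dist_mset_def card_off_diagonal)
  also have "\<dots> < 2 * ((m + 4) * (m + 3))"
    by (simp add: m algebra_simps)
  also have "\<dots> \<le> 2 * (card E * (card E - 1))"
    using assms(4) m by (intro mult_le_mono) auto
  also have "\<dots> \<le> 2 * count (dist_mset d S) x"
    using assms by (intro mult_le_mono2 count_dist_mset_ge) auto
  finally show ?thesis
    unfolding median_dist_def by (rule median_eq_majority)
qed

lemma diam_at_ge:
  assumes "finite S" "A \<in> S" "B \<in> S"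
  shows "d A B \<le> diam_at d S"
proof -
  have "{d A B |A B. A \<in> S \<and> B \<in> S} = (\<lambda>(A, B). d A B) ` (S \<times> S)"
    by auto
  then have "finite {d A B |A B. A \<in> S \<and> B \<in> S}"
    using assms(1) by simp
  then show ?thesis
    unfolding diam_at_def using assms(2,3) by (intro Max_ge) auto
qed

text \<open>For distinct A, B, C the triangle inequality holds because the detour through B adds 2
  \<open>w B\<close> > 0. Positivity also keeps distinct points apart.\<close>

lemma Metric_space_weights:
  fixes w :: "'a \<Rightarrow> real"
  assumes pos: "\<And>a. 0 < w a"
  shows "Metric_space S (\<lambda>A B. if A = B then 0 else w A + w B)"
  using pos add_pos_pos[OF pos pos]
  by unfold_locales (auto simp: less_imp_le less_imp_neq[symmetric])

theorem mainTheorem3: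
  "\<exists>(\<Omega> :: nat \<Rightarrow> nat set) (d :: nat \<Rightarrow> nat \<Rightarrow> real).
     (\<forall>N. finite (\<Omega> N) \<and> card (\<Omega> N) = N) \<and>
     Metric_space (\<Union>N. \<Omega> N) d \<and>
     SWMd \<Omega> d \<and> \<not> SWD \<Omega> d"
proof -
  \<comment> \<open>A single \<open>d\<close> has to serve every N, so the weight cannot depend on
    N. Parity separates the two kinds of points: even numbers are light, at mutual distance 1, and
    odd numbers supply arbitrarily heavy points.\<close>
  define w :: "nat \<Rightarrow> real" where "w n = (if even n then 1/2 else real n)" for n
  define d where "d A B = (if A = B then 0 else w A + w B)" for A B
  define E :: "nat \<Rightarrow> nat set" where "E N = (*) 2 ` {..<N - 1}" for N
  \<comment> \<open>The heavy point changes with N, so the sets are not nested. The case N = 0 is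
    separate because the inserted point would make the set nonempty.\<close>
  define \<Omega> where "\<Omega> N = (if N = 0 then {} else insert (2 * N + 1) (E N))" for N
  have finE: "finite (E N)" and cardE: "card (E N) = N - 1" and evenE: "n \<in> E N \<Longrightarrow> even n" for N n
    by (auto simp: E_def card_image inj_on_def)
  have fin: "finite (\<Omega> N)" for N
    by (simp add: \<Omega>_def finE)
  have "2 * N + 1 \<notin> E N" for N
    using evenE[of "2 * N + 1" N] by auto
  then have card: "card (\<Omega> N) = N" for N
    by (simp add: \<Omega>_def finE cardE)
  have w_pos: "0 < w n" for n
    by (auto simp: w_def odd_pos)
  have "Metric_space (\<Union>N. \<Omega> N) d"
    unfolding d_def by (intro Metric_space_weights w_pos)
  moreover have "SWMd \<Omega> d"
  proof -
    have med: "median_dist d (\<Omega> N) = 1" if "N \<ge> 5" for N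
    proof (rule median_dist_eq[where E = "E N"])
      show "E N \<subseteq> \<Omega> N"
        using that by (auto simp: \<Omega>_def)
      show "d A B = 1" if "A \<in> E N" "B \<in> E N" "A \<noteq> B" for A B
        using that evenE by (simp add: d_def w_def)
    qed (use that in \<open>auto simp: fin card cardE\<close>)
    have "(\<lambda>N. 1 / ln (real N)) \<longlonglongrightarrow> 0"
      by real_asymp
    moreover have "\<forall>\<^sub>F N in sequentially. 1 / ln (real N) = median_dist d (\<Omega> N) / ln (real N)"
      using eventually_ge_at_top[of 5] by eventually_elim (simp add: med)
    ultimately have "(\<lambda>N. median_dist d (\<Omega> N) / ln (real N)) \<longlonglongrightarrow> 0"
      by (rule Lim_transform_eventually)
    then show ?thesis
      unfolding SWMd_def by blast
  qed
  moreover have "\<not> SWD \<Omega> d"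
  proof -
    have diam: "real N \<le> diam_at d (\<Omega> N)" if "N \<ge> 2" for N
    proof -
      \<comment> \<open>N \<ge> 2 ensures that the light point 0 is present; its distance to the
        heavy point is 1/2 + (2N + 1).\<close>
      have "0 \<in> \<Omega> N" "2 * N + 1 \<in> \<Omega> N"
        using that by (auto simp: \<Omega>_def E_def)
      then have "d 0 (2 * N + 1) \<le> diam_at d (\<Omega> N)"
        by (intro diam_at_ge fin)
      then show ?thesis
        by (simp add: d_def w_def)
    qed
    have "filterlim (\<lambda>N. real N / ln (real N)) at_top sequentially"
      by real_asymp
    moreover have "\<forall>\<^sub>F N in sequentially. real N / ln (real N) \<le> diam_at d (\<Omega> N) / ln (real N)"
      using eventually_ge_at_top[of 2]
      by eventually_elim (simp add: diam divide_right_mono)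
    ultimately have "filterlim (\<lambda>N. diam_at d (\<Omega> N) / ln (real N)) at_top sequentially"
      by (rule filterlim_at_top_mono)
    \<comment> \<open>Divergence to infinity excludes every finite limit.\<close>
    then have "\<not> (\<lambda>N. diam_at d (\<Omega> N) / ln (real N)) \<longlonglongrightarrow> C" for C
      by (meson filterlim_at_top_imp_at_infinity not_tendsto_and_filterlim_at_infinity
          sequentially_bot)
    then show ?thesis
      unfolding SWD_def by blast
  qed
  ultimately show ?thesis
    using fin card by blast
qed

end
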